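(* A graph $G$ is leveled planar if and only if it has layered pathwidth $1$.
   Context: Graphs are finite, simple and undirected (with at least one vertex). A leveled planar drawing of a graph is a straight-line crossing-free drawing in the plane such that the vertices are placed on a sequence of parallel lines (levels, numbered consecutively), where each edge joins vertices in two consecutive levels. A graph is leveled planar if it has a leveled planar drawing. A path decomposition of a graph is a sequence of vertex subsets (bags) such that each vertex belongs to a nonempty contiguous subsequence of bags and every two adjacent vertices have at least one bag in common. A layering of a graph is a partition of its vertices into a sequence of disjoint subsets (layers) such that each edge joins vertices in the same layer or in consecutive layers. The layered pathwidth of a graph $G$ is the minimum integer $k$ such that for some path decomposition and some layering of $G$, the intersection of each bag with each layer has at most $k$ vertices. *)

theory Defs
  imports "HOL-Analysis.Analysis" "Graph_Theory.Pair_Digraph"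
begin

text \<open>
  A finite simple undirected graph is a \<^locale>\<open>pair_graph\<close>: a loop-free symmetric relation
  \<^term>\<open>parcs G\<close> on a finite vertex set \<^term>\<open>pverts G\<close>. The undirected edge
  \<open>{u, v}\<close> is represented by the two arcs \<open>(u, v)\<close> and \<open>(v, u)\<close>.
\<close>

text \<open>
  The drawing is determined by the vertex positions \<open>p\<close>. The set inequality \<open>{u, v} \<noteq> {x, y}\<close>
  says that two arcs represent different undirected edges; drawn edges may then meet only in the
  points of common endpoints. The second conjunct forbids an edge from passing through a vertex
  other than its endpoints.
\<close>

definition crossing_free_straight_line_drawing ::
    "'a pair_pre_digraph \<Rightarrow> ('a \<Rightarrow> real \<times> real) \<Rightarrow> bool" where
  "crossing_free_straight_line_drawing G p \<longleftrightarrow>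
     inj_on p (pverts G) \<and>
     (\<forall>(u, v) \<in> parcs G. \<forall>w \<in> pverts G - {u, v}. p w \<notin> closed_segment (p u) (p v)) \<and>
     (\<forall>(u, v) \<in> parcs G. \<forall>(x, y) \<in> parcs G. {u, v} \<noteq> {x, y} \<longrightarrow>
        closed_segment (p u) (p v) \<inter> closed_segment (p x) (p y) \<subseteq> p ` ({u, v} \<inter> {x, y}))"

text \<open>The line with normal vector \<open>n\<close> and offset \<open>c\<close>; lines with the same \<open>n\<close> are parallel.\<close>

definition level_line :: "real \<times> real \<Rightarrow> real \<Rightarrow> (real \<times> real) set" where
  "level_line n c = {q. n \<bullet> q = c}"

text \<open>
  The levels are parallel lines in arbitrary direction and with arbitrary spacing, numbered
  in their geometric order (increasing offsets \<open>cs\<close>). A level need not contain a vertex.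
\<close>

definition leveled_planar_drawing ::
    "'a pair_pre_digraph \<Rightarrow> real \<times> real \<Rightarrow> real list \<Rightarrow> ('a \<Rightarrow> real \<times> real) \<Rightarrow> bool" where
  "leveled_planar_drawing G n cs p \<longleftrightarrow>
     crossing_free_straight_line_drawing G p \<and>
     n \<noteq> 0 \<and> sorted_wrt (<) cs \<and>
     (\<forall>v \<in> pverts G. \<exists>i < length cs. p v \<in> level_line n (cs ! i)) \<and>
     (\<forall>(u, v) \<in> parcs G. \<exists>i. Suc i < length cs \<and>
        (p u \<in> level_line n (cs ! i) \<and> p v \<in> level_line n (cs ! Suc i) \<or>
         p v \<in> level_line n (cs ! i) \<and> p u \<in> level_line n (cs ! Suc i)))"

definition leveled_planar :: "'a pair_pre_digraph \<Rightarrow> bool" where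
  "leveled_planar G \<longleftrightarrow> (\<exists>n cs p. leveled_planar_drawing G n cs p)"

definition path_decomposition :: "'a pair_pre_digraph \<Rightarrow> 'a set list \<Rightarrow> bool" where
  "path_decomposition G bs \<longleftrightarrow>
     (\<forall>B \<in> set bs. B \<subseteq> pverts G) \<and>
     (\<forall>v \<in> pverts G. \<exists>B \<in> set bs. v \<in> B) \<and>
     (\<forall>v i j k. i \<le> j \<and> j \<le> k \<and> k < length bs \<and> v \<in> bs ! i \<and> v \<in> bs ! k \<longrightarrow> v \<in> bs ! j) \<and>
     (\<forall>(u, v) \<in> parcs G. \<exists>B \<in> set bs. u \<in> B \<and> v \<in> B)"

text \<open>Empty layers are permitted; deleting them from a layering leaves a layering.\<close>

definition layering :: "'a pair_pre_digraph \<Rightarrow> 'a set list \<Rightarrow> bool" where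
  "layering G ls \<longleftrightarrow>
     \<Union> (set ls) = pverts G \<and>
     (\<forall>i j. i < j \<and> j < length ls \<longrightarrow> ls ! i \<inter> ls ! j = {}) \<and>
     (\<forall>(u, v) \<in> parcs G. \<exists>i < length ls. \<exists>j < length ls.
        u \<in> ls ! i \<and> v \<in> ls ! j \<and> (i = j \<or> i = Suc j \<or> j = Suc i))"

definition has_layered_width :: "'a pair_pre_digraph \<Rightarrow> nat \<Rightarrow> bool" where
  "has_layered_width G k \<longleftrightarrow>
     (\<exists>bs ls. path_decomposition G bs \<and> layering G ls \<and>
        (\<forall>B \<in> set bs. \<forall>L \<in> set ls. card (B \<inter> L) \<le> k))"

definition layered_pathwidth :: "'a pair_pre_digraph \<Rightarrow> nat" where
  "layered_pathwidth G = (LEAST k. has_layered_width G k)"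

text \<open>The minimum is attained, since a single bag and a single layer always qualify.\<close>

lemma has_layered_width_card:
  assumes "pair_graph G"
  shows "has_layered_width G (card (pverts G))"
proof -
  interpret pair_graph G by fact
  have "path_decomposition G [pverts G]" "layering G [pverts G]"
    by (auto simp: path_decomposition_def layering_def dest: in_arcsD1 in_arcsD2)
  then show ?thesis
    unfolding has_layered_width_def by force
qed

lemma has_layered_width_layered_pathwidth:
  assumes "pair_graph G"
  shows "has_layered_width G (layered_pathwidth G)"
  unfolding layered_pathwidth_def using has_layered_width_card[OF assms] by (rule LeastI)

end

theory Submission
  imports Defs
begin

text \<open>
  Both properties are equivalent to the existence of a purely combinatorial object, a
  \<^emph>\<open>leveled order\<close>: every vertex gets a level and a horizontal coordinate, edges join consecutive
  levels, and two edges between the same two levels do not change the order of their ends.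

  A leveled planar drawing yields a leveled order by taking the coordinate along the levels, since
  two edges whose ends are swapped would cross by the intermediate value theorem
  (\<open>leveled_planar_imp_leveled_order\<close>). Conversely, drawing each vertex at the point given by its
  coordinate and its level is crossing-free (\<open>leveled_order_imp_leveled_planar\<close>).

  From a path decomposition and a layering of width one, take the index of the first bag of a vertex
  as its coordinate. Vertices of the same layer share no bag, so they occupy disjoint intervals of
  bags and the coordinate orders these intervals. The ends of an edge have a common bag, and if two
  edges crossed, then the common bag of each would precede that of the other
  (\<open>layered_width_1_imp_leveled_order\<close>).

  The remaining direction, from a leveled order to a path decomposition, sweeps the drawing from
  left to right. The sweep front consists of the leftmost remaining vertex of each level; it is used
  as a bag. One then wants to delete a front vertex \<open>v\<close> all of whose remaining neighbours are in the
  front, so that all remaining edges at \<open>v\<close> are covered by the current bag. The crucial point is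
  that such a vertex always exists (\<open>leftmost_eliminable\<close>): a front vertex can be blocked by a
  neighbour beyond the front on the level above or below, but by planarity the front
  vertices of two consecutive levels cannot block each other. Once in the front, a vertex stays
  there until it is deleted, so the bags that contain it are consecutive.
\<close>

section \<open>Leveled orders\<close>

text \<open>
  The last conjunct is the absence of crossings within a strip. Its conclusion allows equality,
  because two edges with different ends on one level may share their end on the other level.
\<close>

definition leveled_order :: "'a pair_pre_digraph \<Rightarrow> ('a \<Rightarrow> nat) \<Rightarrow> ('a \<Rightarrow> real) \<Rightarrow> bool" where
  "leveled_order G lev x \<longleftrightarrow>
     (\<forall>u \<in> pverts G. \<forall>v \<in> pverts G. lev u = lev v \<and> x u = x v \<longrightarrow> u = v) \<and>
     (\<forall>(u, v) \<in> parcs G. lev u = Suc (lev v) \<or> lev v = Suc (lev u)) \<and>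
     (\<forall>(u, v) \<in> parcs G. \<forall>(u', v') \<in> parcs G.
        lev u = lev u' \<and> lev v = lev v' \<and> x u < x u' \<longrightarrow> x v \<le> x v')"

lemma leveled_order_eqD:
  "\<lbrakk>leveled_order G lev x; u \<in> pverts G; v \<in> pverts G; lev u = lev v; x u = x v\<rbrakk> \<Longrightarrow> u = v"
  unfolding leveled_order_def by blast

lemma leveled_order_arcD:
  "\<lbrakk>leveled_order G lev x; (u, v) \<in> parcs G\<rbrakk> \<Longrightarrow> lev u = Suc (lev v) \<or> lev v = Suc (lev u)"
  unfolding leveled_order_def by blast

lemma leveled_order_noncrossingD:
  "\<lbrakk>leveled_order G lev x; (u, v) \<in> parcs G; (u', v') \<in> parcs G;
    lev u = lev u'; lev v = lev v'; x u < x u'\<rbrakk> \<Longrightarrow> x v \<le> x v'"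
  unfolding leveled_order_def by blast

lemma parcs_sym:
  assumes "pair_graph G" "(u, v) \<in> parcs G"
  shows "(v, u) \<in> parcs G"
proof -
  interpret pair_graph G by fact
  show ?thesis using assms(2) by (rule arcs_symmetric)
qed

lemma parcs_verts:
  assumes "pair_graph G" "(u, v) \<in> parcs G"
  shows "u \<in> pverts G" "v \<in> pverts G"
proof -
  interpret pair_graph G by fact
  show "u \<in> pverts G" "v \<in> pverts G" using assms(2) by (auto dest: in_arcsD1 in_arcsD2)
qed

lemma parcs_irrefl:
  assumes "pair_graph G"
  shows "(v, v) \<notin> parcs G"
proof -
  interpret pair_graph G by fact
  show ?thesis using no_loops[of "(v, v)"] by auto
qed

lemma finite_pverts:
  assumes "pair_graph G"
  shows "finite (pverts G)"
proof -
  interpret pair_graph G by fact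
  show ?thesis by simp
qed

section \<open>Leveled orders and leveled planar drawings\<close>

text \<open>
  The vector \<open>(- snd n, fst n)\<close> is \<open>n\<close> rotated by a right angle. It gives a coordinate along the
  lines with normal vector \<open>n\<close>, so that together with the offset it determines a point.
\<close>

lemma inner_rotated_eqD:
  fixes n p q :: "real \<times> real"
  assumes "n \<noteq> 0" "n \<bullet> p = n \<bullet> q" "(- snd n, fst n) \<bullet> p = (- snd n, fst n) \<bullet> q"
  shows "p = q"
proof -
  define d where "d = p - q"
  have "n \<bullet> d = 0" "(- snd n, fst n) \<bullet> d = 0"
    using assms(2,3) by (auto simp: d_def inner_diff_right)
  then have e: "fst n * fst d + snd n * snd d = 0" "fst n * snd d - snd n * fst d = 0"
    by (auto simp: inner_prod_def)
  have "((fst n)\<^sup>2 + (snd n)\<^sup>2) * fst d =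
      fst n * (fst n * fst d + snd n * snd d) - snd n * (fst n * snd d - snd n * fst d)"
    "((fst n)\<^sup>2 + (snd n)\<^sup>2) * snd d =
      snd n * (fst n * fst d + snd n * snd d) + fst n * (fst n * snd d - snd n * fst d)"
    by (simp_all add: power2_eq_square algebra_simps)
  moreover have "(fst n)\<^sup>2 + (snd n)\<^sup>2 \<noteq> 0"
    using assms(1) by (simp add: prod_eq_iff sum_power2_eq_zero_iff)
  ultimately have "fst d = 0" "snd d = 0" unfolding e by (metis mult_zero_right diff_zero add_0 mult_eq_0_iff)+
  then show ?thesis by (simp add: d_def prod_eq_iff)
qed

text \<open>
  At equal parameters, the points of two segments between the same two parallel lines lie on a
  common parallel line. If their order along these lines is reversed, they coincide at some
  parameter.
\<close>

lemma closed_segments_swapped_meet: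
  fixes n a b a' b' :: "real \<times> real"
  defines "y \<equiv> \<lambda>q. (- snd n, fst n) \<bullet> q"
  assumes "n \<noteq> 0" "n \<bullet> a = n \<bullet> a'" "n \<bullet> b = n \<bullet> b'" "y a < y a'" "y b' < y b"
  shows "closed_segment a b \<inter> closed_segment a' b' \<noteq> {}"
proof -
  \<comment> \<open>The difference of the coordinates \<open>y\<close> of the two points is an affine function of the parameter
    with values of opposite signs at 0 and 1; \<open>t\<close> is its zero.\<close>
  define D where "D = (y a' - y a) + (y b - y b')"
  define t where "t = (y a' - y a) / D"
  have D: "D > 0" using assms(5,6) by (simp add: D_def)
  have t: "0 \<le> t" "t \<le> 1" using D assms(5,6) by (auto simp: t_def field_simps D_def)
  let ?q = "(1 - t) *\<^sub>R a + t *\<^sub>R b" and ?q' = "(1 - t) *\<^sub>R a' + t *\<^sub>R b'"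
  have "t * D = y a' - y a" using D by (simp add: t_def)
  then have y: "y ?q = y ?q'"
    unfolding D_def y_def by (simp add: inner_add_right algebra_simps)
  have n: "n \<bullet> ?q = n \<bullet> ?q'" using assms(3,4) by (simp add: inner_add_right)
  have "?q = ?q'" using assms(2) n y unfolding y_def by (rule inner_rotated_eqD)
  moreover have "?q \<in> closed_segment a b" "?q' \<in> closed_segment a' b'"
    using t by (auto simp: closed_segment_def)
  ultimately show ?thesis by (metis disjoint_iff)
qed

lemma leveled_planar_imp_leveled_order:
  assumes G: "pair_graph G" and "leveled_planar G"
  shows "\<exists>lev x. leveled_order G lev x"
proof -
  from assms(2) obtain n cs p where d: "leveled_planar_drawing G n cs p"
    unfolding leveled_planar_def by blast
  then have cf: "crossing_free_straight_line_drawing G p" and n: "n \<noteq> 0"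
    and cs: "sorted_wrt (<) cs"
    and on_level: "\<forall>v \<in> pverts G. \<exists>i < length cs. n \<bullet> p v = cs ! i"
    and arc: "\<forall>(u, v) \<in> parcs G. \<exists>i. Suc i < length cs \<and>
       (n \<bullet> p u = cs ! i \<and> n \<bullet> p v = cs ! Suc i \<or> n \<bullet> p v = cs ! i \<and> n \<bullet> p u = cs ! Suc i)"
    unfolding leveled_planar_drawing_def level_line_def by auto
  have cs_inj: "i = j" if "cs ! i = cs ! j" "i < length cs" "j < length cs" for i j
    using that cs by (metis nat_neq_iff order_less_irrefl sorted_wrt_nth_less)
  obtain lev where lev: "\<And>v. v \<in> pverts G \<Longrightarrow> lev v < length cs \<and> n \<bullet> p v = cs ! lev v"
    using on_level by metis
  define x where "x v = (- snd n, fst n) \<bullet> p v" for v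
  have adj: "lev u = Suc (lev v) \<or> lev v = Suc (lev u)" if "(u, v) \<in> parcs G" for u v
  proof -
    obtain i where "Suc i < length cs"
      "n \<bullet> p u = cs ! i \<and> n \<bullet> p v = cs ! Suc i \<or> n \<bullet> p v = cs ! i \<and> n \<bullet> p u = cs ! Suc i"
      using arc \<open>(u, v) \<in> parcs G\<close> by blast
    then show ?thesis
      using lev[OF parcs_verts(1)[OF G that]] lev[OF parcs_verts(2)[OF G that]] cs_inj
      by (metis Suc_lessD)
  qed
  have "leveled_order G lev x"
    unfolding leveled_order_def
  proof (intro conjI ballI impI; (clarify)?)
    fix u v assume uv: "u \<in> pverts G" "v \<in> pverts G" "lev u = lev v" "x u = x v"
    then have "p u = p v"
      using n lev[of u] lev[of v] by (intro inner_rotated_eqD[of n]) (auto simp: x_def)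
    then show "u = v"
      using cf uv by (auto simp: crossing_free_straight_line_drawing_def inj_on_def)
  next
    fix u v assume "(u, v) \<in> parcs G" "lev v \<noteq> Suc (lev u)"
    then show "lev u = Suc (lev v)" using adj by blast
  next
    fix u v u' v' assume e: "(u, v) \<in> parcs G" "(u', v') \<in> parcs G"
      and l: "lev u = lev u'" "lev v = lev v'" and xu: "x u < x u'"
    show "x v \<le> x v'"
    proof (rule ccontr)
      assume "\<not> x v \<le> x v'"
      then have xv: "x v' < x v" by simp
      have "closed_segment (p u) (p v) \<inter> closed_segment (p u') (p v') \<noteq> {}"
        using n l xu xv lev[OF parcs_verts(1)[OF G e(1)]] lev[OF parcs_verts(2)[OF G e(1)]]
          lev[OF parcs_verts(1)[OF G e(2)]] lev[OF parcs_verts(2)[OF G e(2)]]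
        by (intro closed_segments_swapped_meet) (auto simp: x_def)
      moreover have dis: "{u, v} \<inter> {u', v'} = {}"
      proof -
        have "lev u \<noteq> lev v'" "lev v \<noteq> lev u'" using adj[OF e(1)] l by linarith+
        then show ?thesis using xu xv by blast
      qed
      moreover from dis have "{u, v} \<noteq> {u', v'}" by blast
      then have "closed_segment (p u) (p v) \<inter> closed_segment (p u') (p v')
          \<subseteq> p ` ({u, v} \<inter> {u', v'})"
        using cf e unfolding crossing_free_straight_line_drawing_def by blast
      ultimately show False by simp
    qed
  qed
  then show ?thesis by blast
qed

lemma mem_closed_segment_unit_strip:
  assumes "q \<in> closed_segment (a, real i) (b, real (Suc i))"
  obtains t where "0 \<le> t" "t \<le> 1" "fst q = (1 - t) * a + t * b" "snd q = real i + t"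
proof -
  obtain t where t: "0 \<le> t" "t \<le> 1"
      "q = (1 - t) *\<^sub>R (a, real i) + t *\<^sub>R (b, real (Suc i))"
    using assms by (auto simp: closed_segment_def)
  show ?thesis
    by (rule that[of t]) (use t in \<open>auto simp: algebra_simps\<close>)
qed

text \<open>
  For two edges in the same strip, the horizontal distance at a given height is a convex combination
  of the distances between their lower ends and between their upper ends. These are both nonnegative
  and not both zero, so the edges can only meet at a common end. Edges in different strips can only
  meet on the level between adjacent strips, where both have an end.
\<close>

lemma leveled_order_upward_segments:
  assumes G: "pair_graph G" and lo: "leveled_order G lev x"
    and e: "(u, v) \<in> parcs G" "(u', v') \<in> parcs G"
    and up: "lev v = Suc (lev u)" "lev v' = Suc (lev u')"
    and le: "lev u < lev u' \<or> lev u = lev u' \<and> x u \<le> x u'"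
    and ne: "{u, v} \<noteq> {u', v'}"
  defines "p \<equiv> \<lambda>v. (x v, real (lev v))"
  shows "closed_segment (p u) (p v) \<inter> closed_segment (p u') (p v') \<subseteq> p ` ({u, v} \<inter> {u', v'})"
proof
  fix q assume q: "q \<in> closed_segment (p u) (p v) \<inter> closed_segment (p u') (p v')"
  note V = parcs_verts[OF G e(1)] parcs_verts[OF G e(2)]
  obtain t where t: "0 \<le> t" "t \<le> 1" "fst q = (1 - t) * x u + t * x v" "snd q = real (lev u) + t"
    using mem_closed_segment_unit_strip[of q "x u" "lev u" "x v"] q up by (auto simp: p_def)
  obtain s where s: "0 \<le> s" "s \<le> 1" "fst q = (1 - s) * x u' + s * x v'" "snd q = real (lev u') + s"
    using mem_closed_segment_unit_strip[of q "x u'" "lev u'" "x v'"] q up by (auto simp: p_def)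
  show "q \<in> p ` ({u, v} \<inter> {u', v'})"
  proof (cases "lev u = lev u'")
    case True
    with t s have st: "s = t" by simp
    have eq: "(1 - t) * (x u' - x u) + t * (x v' - x v) = 0"
      using t(3) s(3) st by (simp add: algebra_simps)
    show ?thesis
    proof (cases "x u = x u'")
      case xu: True
      then have "u = u'" using leveled_order_eqD[OF lo] V True by blast
      then have "v \<noteq> v'" using ne by auto
      then have "x v \<noteq> x v'" using leveled_order_eqD[OF lo] V True up by metis
      with eq xu have "t = 0" by simp
      then have "q = p u" using t by (simp add: p_def prod_eq_iff)
      with \<open>u = u'\<close> show ?thesis by simp
    next
      case False
      with le True have xu: "x u < x u'" by simp
      have xv: "x v \<le> x v'"
        using leveled_order_noncrossingD[OF lo e] True up xu by simp
      have nn: "(1 - t) * (x u' - x u) \<ge> 0" "t * (x v' - x v) \<ge> 0" using t xu xv by auto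
      with eq have "(1 - t) * (x u' - x u) = 0" "t * (x v' - x v) = 0" by linarith+
      with xu have t1: "t = 1" and "x v' = x v" by auto
      then have "v = v'" using leveled_order_eqD[OF lo] V True up by metis
      moreover have "q = p v" using t(3,4) t1 up(1) by (simp add: p_def prod_eq_iff)
      ultimately show ?thesis by simp
    qed
  next
    case False
    with le have "lev u < lev u'" by simp
    then have lev: "lev u' = Suc (lev u)" and t1: "t = 1" and s0: "s = 0"
      using t(2,4) s(1,4) by linarith+
    have "q = p v" using t(3,4) t1 up(1) by (simp add: p_def prod_eq_iff)
    moreover have "q = p u'" using s(3,4) s0 by (simp add: p_def prod_eq_iff)
    moreover have "v = u'"
      using leveled_order_eqD[OF lo V(2) V(3)] calculation by (simp add: p_def)
    ultimately show ?thesis by simp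
  qed
qed

lemma leveled_order_imp_leveled_planar:
  assumes G: "pair_graph G" and lo: "leveled_order G lev x"
  shows "leveled_planar G"
proof -
  define p where "p v = (x v, real (lev v))" for v
  define cs where "cs = map real [0..<Suc (Max (lev ` pverts G))]"
  have lev_less: "lev v < length cs" if "v \<in> pverts G" for v
    using that finite_pverts[OF G] by (simp add: cs_def less_Suc_eq_le)
  have cs_nth: "cs ! i = real i" if "i < length cs" for i
    using that by (simp add: cs_def del: upt_Suc)
  have on_line: "p v \<in> level_line (0, 1) (cs ! lev v)" if "v \<in> pverts G" for v
    using cs_nth[OF lev_less[OF that]] by (simp add: level_line_def p_def)
  have through: "p w \<notin> closed_segment (p u) (p v)"
    if uv: "(u, v) \<in> parcs G" and w: "w \<in> pverts G" "w \<noteq> u" "w \<noteq> v"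
      and up: "lev v = Suc (lev u)" for u v w
  proof
    assume "p w \<in> closed_segment (p u) (p v)"
    then obtain t where t: "0 \<le> t" "t \<le> 1" "x w = (1 - t) * x u + t * x v"
        "real (lev w) = real (lev u) + t"
      using mem_closed_segment_unit_strip[of "p w" "x u" "lev u" "x v"] up
      unfolding p_def by (metis fst_conv snd_conv)
    then have "lev w = lev u \<or> lev w = Suc (lev u)" by linarith
    with t have "lev w = lev u \<and> t = 0 \<or> lev w = Suc (lev u) \<and> t = 1" by auto
    then show False
    proof (elim disjE conjE)
      assume "lev w = lev u" "t = 0"
      then show False
        using leveled_order_eqD[OF lo w(1) parcs_verts(1)[OF G uv]] t(3) w(2) by simp
    next
      assume "lev w = Suc (lev u)" "t = 1"
      then show False
        using leveled_order_eqD[OF lo w(1) parcs_verts(2)[OF G uv]] t(3) up w(3) by simp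
    qed
  qed
  have up: "closed_segment (p u) (p v) \<inter> closed_segment (p u') (p v') \<subseteq> p ` ({u, v} \<inter> {u', v'})"
    if "(u, v) \<in> parcs G" "(u', v') \<in> parcs G" "lev v = Suc (lev u)" "lev v' = Suc (lev u')"
      "{u, v} \<noteq> {u', v'}" for u v u' v'
  proof (cases "lev u < lev u' \<or> lev u = lev u' \<and> x u \<le> x u'")
    case True
    show ?thesis
      unfolding p_def by (rule leveled_order_upward_segments[OF G lo that(1-4) True that(5)])
  next
    case False
    then have "lev u' < lev u \<or> lev u' = lev u \<and> x u' \<le> x u" by linarith
    from leveled_order_upward_segments[OF G lo that(2,1,4,3) this that(5)[symmetric]]
    show ?thesis unfolding p_def by (metis Int_commute)
  qed
  \<comment> \<open>Each arc can be replaced by its upward orientation, which draws the same segment.\<close>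
  have orient: "\<exists>a b. (a, b) \<in> parcs G \<and> lev b = Suc (lev a) \<and> {a, b} = {u, v} \<and>
      closed_segment (p a) (p b) = closed_segment (p u) (p v)" if "(u, v) \<in> parcs G" for u v
    using leveled_order_arcD[OF lo that] parcs_sym[OF G that] that
    by (metis closed_segment_commute insert_commute)
  have through_any: "p w \<notin> closed_segment (p u) (p v)"
    if uv: "(u, v) \<in> parcs G" and w: "w \<in> pverts G - {u, v}" for u v w
  proof -
    obtain a b where ab: "(a, b) \<in> parcs G" "lev b = Suc (lev a)" "{a, b} = {u, v}"
      "closed_segment (p a) (p b) = closed_segment (p u) (p v)" using orient[OF uv] by blast
    have "w \<noteq> a" "w \<noteq> b" using w ab(3) by auto
    then show ?thesis using through[OF ab(1) _ _ _ ab(2)] w ab(4) by simp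
  qed
  have cross_any: "closed_segment (p u) (p v) \<inter> closed_segment (p u') (p v')
      \<subseteq> p ` ({u, v} \<inter> {u', v'})"
    if e: "(u, v) \<in> parcs G" "(u', v') \<in> parcs G" and ne: "{u, v} \<noteq> {u', v'}" for u v u' v'
  proof -
    obtain a b where ab: "(a, b) \<in> parcs G" "lev b = Suc (lev a)" "{a, b} = {u, v}"
      "closed_segment (p a) (p b) = closed_segment (p u) (p v)" using orient[OF e(1)] by blast
    obtain a' b' where ab': "(a', b') \<in> parcs G" "lev b' = Suc (lev a')" "{a', b'} = {u', v'}"
      "closed_segment (p a') (p b') = closed_segment (p u') (p v')" using orient[OF e(2)] by blast
    have "{a, b} \<noteq> {a', b'}" unfolding ab(3) ab'(3) by (rule ne)
    from up[OF ab(1) ab'(1) ab(2) ab'(2) this] show ?thesis unfolding ab(3,4) ab'(3,4) .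
  qed
  have "crossing_free_straight_line_drawing G p"
    unfolding crossing_free_straight_line_drawing_def
  proof (intro conjI ballI case_prodI2 impI)
    show "inj_on p (pverts G)"
      using leveled_order_eqD[OF lo] by (auto simp: inj_on_def p_def)
  qed (use through_any cross_any in simp_all)
  moreover have "\<exists>i. Suc i < length cs \<and>
      (p u \<in> level_line (0, 1) (cs ! i) \<and> p v \<in> level_line (0, 1) (cs ! Suc i) \<or>
       p v \<in> level_line (0, 1) (cs ! i) \<and> p u \<in> level_line (0, 1) (cs ! Suc i))"
    if "(u, v) \<in> parcs G" for u v
    using leveled_order_arcD[OF lo that] on_line lev_less parcs_verts[OF G that] by metis
  moreover have "sorted_wrt (<) cs"
    by (simp add: cs_def sorted_wrt_map del: upt_Suc)
  ultimately have "leveled_planar_drawing G (0, 1) cs p"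
    unfolding leveled_planar_drawing_def
    using on_line lev_less by (fastforce simp: zero_prod_def)
  then show ?thesis unfolding leveled_planar_def by blast
qed

section \<open>The left-to-right sweep of a leveled order\<close>

text \<open>The sweep front of a set of remaining vertices.\<close>

definition leftmost :: "('a \<Rightarrow> nat) \<Rightarrow> ('a \<Rightarrow> real) \<Rightarrow> 'a set \<Rightarrow> 'a set" where
  "leftmost lev x S = {v \<in> S. \<forall>w \<in> S. lev w = lev v \<longrightarrow> x v \<le> x w}"

lemma leftmost_subset: "leftmost lev x S \<subseteq> S"
  by (auto simp: leftmost_def)

lemma leftmost_antimono: "\<lbrakk>v \<in> leftmost lev x S; v \<in> T; T \<subseteq> S\<rbrakk> \<Longrightarrow> v \<in> leftmost lev x T"
  by (auto simp: leftmost_def)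

lemma leftmost_exists:
  assumes "finite S" "w \<in> S"
  obtains v where "v \<in> leftmost lev x S" "lev v = lev w"
proof -
  let ?L = "{v \<in> S. lev v = lev w}"
  have "finite ?L" "?L \<noteq> {}" using assms by auto
  then obtain v where "v \<in> ?L" "\<forall>u\<in>?L. x v \<le> x u"
    using arg_min_if_finite(1)[of ?L x] arg_min_least[of ?L _ x] by (metis (no_types, lifting))
  then show ?thesis using that by (auto simp: leftmost_def)
qed

text \<open>
  The vertex is the lowest front vertex \<open>v\<close> that is not blocked from above, i.e. whose upper
  neighbours are all in the front. The front vertex of the top level shows that there is one. If \<open>v\<close>
  were blocked from below, by a neighbour \<open>w\<close> beyond the front vertex \<open>w0\<close> of the level below, then
  by minimality \<open>w0\<close> would be blocked from above by some \<open>z\<close> beyond \<open>v\<close>, and the edges from \<open>w0\<close>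
  to \<open>z\<close> and from \<open>w\<close> to \<open>v\<close> would cross.
\<close>

lemma leftmost_eliminable:
  assumes G: "pair_graph G" and lo: "leveled_order G lev x"
    and S: "finite S" "S \<noteq> {}" "S \<subseteq> pverts G"
  obtains v where "v \<in> leftmost lev x S"
    "\<And>w. w \<in> S \<Longrightarrow> (v, w) \<in> parcs G \<Longrightarrow> w \<in> leftmost lev x S"
proof -
  let ?L = "leftmost lev x S"
  define U where "U = {v \<in> ?L. \<forall>w \<in> S. (v, w) \<in> parcs G \<and> lev w = Suc (lev v) \<longrightarrow> w \<in> ?L}"
  have "U \<noteq> {}"
  proof -
    have "Max (lev ` S) \<in> lev ` S" using S by simp
    then obtain s where s: "s \<in> S" "lev s = Max (lev ` S)" by auto
    obtain v where v: "v \<in> ?L" "lev v = lev s" using leftmost_exists[OF S(1) s(1)] .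
    have "lev w \<noteq> Suc (lev v)" if "w \<in> S" for w
    proof -
      have "lev w \<le> Max (lev ` S)" using S(1) that by simp
      then show ?thesis using s(2) v(2) by linarith
    qed
    then have "v \<in> U" using v(1) unfolding U_def by blast
    then show ?thesis by blast
  qed
  moreover have "finite U"
    using finite_subset[OF leftmost_subset S(1)] by (simp add: U_def)
  ultimately obtain v where v: "v \<in> U" "\<forall>u\<in>U. lev v \<le> lev u"
    using arg_min_if_finite(1)[of U lev] arg_min_least[of U _ lev] by metis
  show ?thesis
  proof (rule that)
    show "v \<in> ?L" using v by (simp add: U_def)
    fix w assume w: "w \<in> S" "(v, w) \<in> parcs G"
    show "w \<in> ?L"
    proof (rule ccontr)
      assume wn: "w \<notin> ?L"
      then have lw: "lev v = Suc (lev w)"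
        using leveled_order_arcD[OF lo w(2)] v(1) w by (auto simp: U_def)
      obtain w0 where w0: "w0 \<in> ?L" "lev w0 = lev w" using leftmost_exists[OF S(1) w(1)] .
      have "w0 \<notin> U" using v(2) lw w0 by force
      then obtain z where z: "z \<in> S" "(w0, z) \<in> parcs G" "lev z = Suc (lev w0)" "z \<notin> ?L"
        using w0 by (auto simp: U_def)
      have strict: "x a < x b" if "a \<in> ?L" "b \<in> S - ?L" "lev a = lev b" for a b
      proof -
        have "x a \<le> x b" using that by (auto simp: leftmost_def)
        moreover have "x a \<noteq> x b" 
          using leveled_order_eqD[OF lo, of a b] that S leftmost_subset[of lev x S] by blast
        ultimately show ?thesis by simp
      qed
      have "x w0 < x w" using strict[of w0 w] w0 w wn by simp
      then have "x z \<le> x v"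
        using leveled_order_noncrossingD[OF lo z(2) parcs_sym[OF G w(2)]] w0 lw z by simp
      moreover have "x v < x z"
        using strict[of v z] v(1) z w0 lw by (simp add: U_def)
      ultimately show False by simp
    qed
  qed
qed

text \<open>
  The vertices in their order of deletion: \<open>drop i vs\<close> lists what remains when \<open>vs ! i\<close> is deleted.
\<close>

lemma elimination_order_exists:
  assumes G: "pair_graph G" and lo: "leveled_order G lev x"
    and "finite S" "S \<subseteq> pverts G"
  shows "\<exists>vs. set vs = S \<and> (\<forall>i < length vs. vs ! i \<in> leftmost lev x (set (drop i vs)) \<and>
    (\<forall>w \<in> set (drop i vs). (vs ! i, w) \<in> parcs G \<longrightarrow> w \<in> leftmost lev x (set (drop i vs))))"
  using assms(3,4)
proof (induction S rule: finite_psubset_induct)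
  case (psubset S)
  show ?case
  proof (cases "S = {}")
    case True
    then show ?thesis by simp
  next
    case False
    obtain v where v: "v \<in> leftmost lev x S"
      "\<And>w. w \<in> S \<Longrightarrow> (v, w) \<in> parcs G \<Longrightarrow> w \<in> leftmost lev x S"
      using leftmost_eliminable[OF G lo psubset.hyps False psubset.prems] by blast
    have vS: "v \<in> S" using subsetD[OF leftmost_subset v(1)] .
    then obtain vs where vs: "set vs = S - {v}"
      "\<forall>i < length vs. vs ! i \<in> leftmost lev x (set (drop i vs)) \<and>
        (\<forall>w \<in> set (drop i vs). (vs ! i, w) \<in> parcs G \<longrightarrow> w \<in> leftmost lev x (set (drop i vs)))"
      using psubset.IH[of "S - {v}"] psubset.prems vS by auto
    have S: "set (v # vs) = S" using vs(1) vS by auto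
    show ?thesis
    proof (intro exI[of _ "v # vs"] conjI allI impI S)
      fix i assume i: "i < length (v # vs)"
      then show "(v # vs) ! i \<in> leftmost lev x (set (drop i (v # vs)))"
        using vs(2) v(1) S by (cases i) auto
      show "\<forall>w \<in> set (drop i (v # vs)). ((v # vs) ! i, w) \<in> parcs G \<longrightarrow>
          w \<in> leftmost lev x (set (drop i (v # vs)))"
      proof (cases i)
        case 0
        then show ?thesis using v(2) S by simp
      next
        case (Suc j)
        then show ?thesis using vs(2) i by simp
      qed
    qed
  qed
qed

section \<open>Leveled orders and layered path decompositions of width one\<close>

text \<open>
  The layers are the levels and the bags are the successive sweep fronts. An edge is covered by the
  bag at the deletion of its first end, and contiguity holds because front membership persists
  while the set of remaining vertices shrinks.
\<close>

lemma leveled_order_imp_layered_width_1: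
  assumes G: "pair_graph G" and lo: "leveled_order G lev x"
  shows "has_layered_width G 1"
proof -
  obtain vs where vs: "set vs = pverts G"
    and elim: "\<And>i. i < length vs \<Longrightarrow> vs ! i \<in> leftmost lev x (set (drop i vs))"
    and elim_nbr: "\<And>i w. \<lbrakk>i < length vs; w \<in> set (drop i vs); (vs ! i, w) \<in> parcs G\<rbrakk>
        \<Longrightarrow> w \<in> leftmost lev x (set (drop i vs))"
    using elimination_order_exists[OF G lo finite_pverts[OF G] subset_refl] by blast
  define bag where "bag i = leftmost lev x (set (drop i vs))" for i
  define bs where "bs = map bag [0..<length vs]"
  define ls where "ls = map (\<lambda>i. {v \<in> pverts G. lev v = i}) [0..<Suc (Max (lev ` pverts G))]"
  have bag_sub: "bag i \<subseteq> set (drop i vs)" for i unfolding bag_def by (rule leftmost_subset)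
  have bag_verts: "bag i \<subseteq> pverts G" for i using bag_sub[of i] vs set_drop_subset by fastforce
  have edge: "vs ! i \<in> bag i \<and> vs ! j \<in> bag i"
    if "i \<le> j" "j < length vs" "(vs ! i, vs ! j) \<in> parcs G" for i j
  proof -
    have "vs ! j = drop i vs ! (j - i)" "j - i < length (drop i vs)" using that by auto
    then have "vs ! j \<in> set (drop i vs)" by (metis nth_mem)
    then show ?thesis using that elim[of i] elim_nbr[of i "vs ! j"] by (simp add: bag_def)
  qed
  have "path_decomposition G bs"
    unfolding path_decomposition_def
  proof (intro conjI)
    show "\<forall>B\<in>set bs. B \<subseteq> pverts G" using bag_verts by (auto simp: bs_def)
    show "\<forall>v\<in>pverts G. \<exists>B\<in>set bs. v \<in> B"
    proof
      fix v assume "v \<in> pverts G"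
      then obtain i where "i < length vs" "v = vs ! i" using vs by (metis in_set_conv_nth)
      then show "\<exists>B\<in>set bs. v \<in> B" using elim[of i] by (auto simp: bs_def bag_def)
    qed
    show "\<forall>v i j k. i \<le> j \<and> j \<le> k \<and> k < length bs \<and> v \<in> bs ! i \<and> v \<in> bs ! k \<longrightarrow> v \<in> bs ! j"
    proof (intro allI impI, elim conjE)
      fix v i j k assume a: "i \<le> j" "j \<le> k" "k < length bs" "v \<in> bs ! i" "v \<in> bs ! k"
      then have "v \<in> bag i" "v \<in> bag k" by (auto simp: bs_def)
      moreover have "v \<in> set (drop j vs)"
        using \<open>v \<in> bag k\<close> bag_sub[of k] set_drop_subset_set_drop[OF a(2), of vs] by blast
      ultimately have "v \<in> bag j"
        using leftmost_antimono[OF _ _ set_drop_subset_set_drop[OF a(1), of vs]]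
        unfolding bag_def by simp
      then show "v \<in> bs ! j" using a by (simp add: bs_def)
    qed
    show "\<forall>(u, v)\<in>parcs G. \<exists>B\<in>set bs. u \<in> B \<and> v \<in> B"
    proof clarify
      fix u v assume uv: "(u, v) \<in> parcs G"
      obtain i j where ij: "i < length vs" "u = vs ! i" "j < length vs" "v = vs ! j"
        using parcs_verts[OF G uv] vs by (metis in_set_conv_nth)
      show "\<exists>B\<in>set bs. u \<in> B \<and> v \<in> B"
      proof (cases "i \<le> j")
        case True
        then show ?thesis using edge[of i j] ij uv by (auto simp: bs_def)
      next
        case False
        then show ?thesis using edge[of j i] ij parcs_sym[OF G uv] by (auto simp: bs_def)
      qed
    qed
  qed
  moreover have "layering G ls"
  proof -
    have lev_less: "lev v < length ls" if "v \<in> pverts G" for v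
      using that finite_pverts[OF G] by (simp add: ls_def less_Suc_eq_le)
    have ls_nth: "ls ! i = {v \<in> pverts G. lev v = i}" if "i < length ls" for i
      using that by (simp add: ls_def del: upt_Suc)
    have own: "v \<in> ls ! lev v" if "v \<in> pverts G" for v
      using ls_nth[OF lev_less[OF that]] that by simp
    show ?thesis
      unfolding layering_def
    proof (intro conjI)
      show "\<Union> (set ls) = pverts G"
        using own lev_less nth_mem[of _ ls] by (fastforce simp: ls_def)
      show "\<forall>i j. i < j \<and> j < length ls \<longrightarrow> ls ! i \<inter> ls ! j = {}"
        by (auto simp: ls_nth)
      show "\<forall>(u, v)\<in>parcs G. \<exists>i<length ls. \<exists>j<length ls.
          u \<in> ls ! i \<and> v \<in> ls ! j \<and> (i = j \<or> i = Suc j \<or> j = Suc i)"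
      proof clarify
        fix u v assume uv: "(u, v) \<in> parcs G"
        note V = parcs_verts[OF G uv]
        show "\<exists>i<length ls. \<exists>j<length ls.
            u \<in> ls ! i \<and> v \<in> ls ! j \<and> (i = j \<or> i = Suc j \<or> j = Suc i)"
          by (rule exI[of _ "lev u"], rule conjI[OF lev_less[OF V(1)]],
              rule exI[of _ "lev v"], rule conjI[OF lev_less[OF V(2)]])
            (use own[OF V(1)] own[OF V(2)] leveled_order_arcD[OF lo uv] in blast)
      qed
    qed
  qed
  moreover have "card (B \<inter> L) \<le> 1" if "B \<in> set bs" "L \<in> set ls" for B L
  proof -
    obtain i where B: "B = bag i" using \<open>B \<in> set bs\<close> by (auto simp: bs_def)
    obtain l where L: "L = {v \<in> pverts G. lev v = l}"
      using \<open>L \<in> set ls\<close> by (auto simp: ls_def)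
    have "u = v" if "u \<in> B \<inter> L" "v \<in> B \<inter> L" for u v
    proof (rule leveled_order_eqD[OF lo])
      show "x u = x v"
        using that bag_sub[of i] unfolding B L bag_def leftmost_def by (simp add: order_antisym)
    qed (use that L in auto)
    moreover have "finite (B \<inter> L)" using finite_pverts[OF G] L by simp
    ultimately show ?thesis by (simp add: card_le_Suc0_iff_eq)
  qed
  ultimately show ?thesis unfolding has_layered_width_def by blast
qed

text \<open>
  Besides the absence of crossings, width one excludes edges inside a layer, because the ends of an
  edge share a bag.
\<close>

lemma layered_width_1_imp_leveled_order:
  assumes G: "pair_graph G" and "has_layered_width G 1"
  shows "\<exists>lev x. leveled_order G lev x"
proof -
  obtain bs ls where pd: "path_decomposition G bs" and lay: "layering G ls"
    and w: "\<And>B L. \<lbrakk>B \<in> set bs; L \<in> set ls\<rbrakk> \<Longrightarrow> card (B \<inter> L) \<le> 1"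
    using assms(2) unfolding has_layered_width_def by blast
  have bag_ex: "\<exists>i < length bs. v \<in> bs ! i" if "v \<in> pverts G" for v
    using pd that unfolding path_decomposition_def by (metis in_set_conv_nth)
  have contig: "v \<in> bs ! j" if "i \<le> j" "j \<le> k" "k < length bs" "v \<in> bs ! i" "v \<in> bs ! k" for v i j k
    using pd that unfolding path_decomposition_def by blast
  have common_bag: "\<exists>i < length bs. u \<in> bs ! i \<and> v \<in> bs ! i" if "(u, v) \<in> parcs G" for u v
  proof -
    have "\<exists>B \<in> set bs. u \<in> B \<and> v \<in> B" using pd that unfolding path_decomposition_def by blast
    then show ?thesis by (metis in_set_conv_nth)
  qed
  have "\<exists>i < length ls. v \<in> ls ! i" if "v \<in> pverts G" for v
  proof -
    have "v \<in> \<Union> (set ls)" using lay that unfolding layering_def by simp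
    then show ?thesis by (auto simp: in_set_conv_nth)
  qed
  then obtain lev where lev: "\<And>v. v \<in> pverts G \<Longrightarrow> lev v < length ls \<and> v \<in> ls ! lev v"
    by metis
  have lev_unique: "i = lev v" if "i < length ls" "v \<in> ls ! i" "v \<in> pverts G" for i v
  proof -
    have "ls ! i \<inter> ls ! j = {}" if "i < j" "j < length ls" for i j
      using lay that unfolding layering_def by blast
    then show ?thesis using lev[OF that(3)] that(1,2) by (metis disjoint_iff nat_neq_iff)
  qed
  have same: "u = v" if "i < length bs" "u \<in> bs ! i" "v \<in> bs ! i" "lev u = lev v" 
    "u \<in> pverts G" "v \<in> pverts G" for u v i
  proof -
    let ?I = "bs ! i \<inter> ls ! lev u"
    have "card ?I \<le> 1" using w that lev by simp
    moreover have "bs ! i \<subseteq> pverts G"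
      using pd that(1) unfolding path_decomposition_def by simp
    then have "finite ?I" using finite_pverts[OF G] by (meson finite_Int finite_subset)
    moreover have "u \<in> ?I" "v \<in> ?I" using lev[of u] lev[of v] that by auto
    ultimately show ?thesis by (auto simp: card_le_Suc0_iff_eq)
  qed
  define first where "first v = (LEAST i. v \<in> bs ! i)" for v
  have first: "v \<in> bs ! first v" "first v < length bs" if "v \<in> pverts G" for v
    using bag_ex[OF that] unfolding first_def by (metis LeastI, metis Least_le le_less_trans)
  have first_le: "first v \<le> i" if "v \<in> bs ! i" for v i
    unfolding first_def using that by (rule Least_le)
  \<comment> \<open>In one layer, every bag of the earlier vertex precedes every bag of the later one.\<close>
  have before: "i < j" if "first u < first u'" "lev u = lev u'" "u \<in> bs ! i" "u' \<in> bs ! j"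
    "i < length bs" "u \<in> pverts G" "u' \<in> pverts G" for u u' i j
  proof (rule ccontr)
    assume "\<not> i < j"
    moreover have "first u \<le> j" using first_le[OF that(4)] that(1) by simp
    ultimately have "u \<in> bs ! j" using contig[of "first u" j i u] first[of u] that by simp
    then have "u = u'" using same[of j u u'] that \<open>\<not> i < j\<close> by simp
    then show False using that by simp
  qed
  have "leveled_order G lev (\<lambda>v. real (first v))"
    unfolding leveled_order_def
  proof (intro conjI; clarify)
    fix u v assume "u \<in> pverts G" "v \<in> pverts G" "lev u = lev v" "real (first u) = real (first v)"
    then show "u = v" using same[of "first u" u v] first[of u] first[of v] by simp
  next
    fix u v assume uv: "(u, v) \<in> parcs G" and n: "lev v \<noteq> Suc (lev u)"
    note V = parcs_verts[OF G uv]
    obtain i j where ij: "i < length ls" "j < length ls" "u \<in> ls ! i" "v \<in> ls ! j"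
      "i = j \<or> i = Suc j \<or> j = Suc i"
      using lay uv unfolding layering_def by blast
    then have "i = lev u" "j = lev v" using lev_unique V by blast+
    moreover have "lev u \<noteq> lev v"
    proof
      assume "lev u = lev v"
      then have "u = v" using common_bag[OF uv] same V by blast
      then show False using parcs_irrefl[OF G] uv by blast
    qed
    ultimately show "lev u = Suc (lev v)" using ij n by auto
  next
    fix u v u' v' assume e: "(u, v) \<in> parcs G" "(u', v') \<in> parcs G"
      and l: "lev u = lev u'" "lev v = lev v'" and lt: "real (first u) < real (first u')"
    note V = parcs_verts[OF G e(1)] parcs_verts[OF G e(2)]
    obtain i j where i: "i < length bs" "u \<in> bs ! i" "v \<in> bs ! i"
      and j: "j < length bs" "u' \<in> bs ! j" "v' \<in> bs ! j" using common_bag e by metis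
    have "i < j" using before[of u u' i j] l lt i j V by simp
    show "real (first v) \<le> real (first v')"
    proof (rule ccontr)
      assume "\<not> ?thesis"
      then have "j < i" using before[of v' v j i] l i j V by simp
      with \<open>i < j\<close> show False by simp
    qed
  qed
  then show ?thesis by blast
qed

lemma leveled_planar_iff_layered_width_1:
  assumes "pair_graph G"
  shows "leveled_planar G \<longleftrightarrow> has_layered_width G 1"
  using assms leveled_planar_imp_leveled_order leveled_order_imp_leveled_planar
    leveled_order_imp_layered_width_1 layered_width_1_imp_leveled_order by metis

lemma layered_width_pos:
  assumes G: "pair_graph G" and "pverts G \<noteq> {}" and "has_layered_width G k"
  shows "0 < k"
proof -
  obtain bs ls where pd: "path_decomposition G bs" and lay: "layering G ls"
    and w: "\<forall>B \<in> set bs. \<forall>L \<in> set ls. card (B \<inter> L) \<le> k"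
    using assms(3) unfolding has_layered_width_def by blast
  obtain v where v: "v \<in> pverts G" using assms(2) by blast
  obtain B where B: "B \<in> set bs" "v \<in> B" using pd v unfolding path_decomposition_def by blast
  obtain L where L: "L \<in> set ls" "v \<in> L" using lay v unfolding layering_def by blast
  have "B \<subseteq> pverts G" using pd B(1) unfolding path_decomposition_def by blast
  then have "finite (B \<inter> L)" using finite_pverts[OF G] by (meson finite_Int finite_subset)
  then have "0 < card (B \<inter> L)" using B L by (auto simp: card_gt_0_iff)
  then show ?thesis using w B(1) L(1) by fastforce
qed

theorem theorem6:
  fixes G :: "'a pair_pre_digraph"
  assumes "pair_graph G" and "pverts G \<noteq> {}"
  shows "leveled_planar G \<longleftrightarrow> layered_pathwidth G = 1"
proof -
  have "has_layered_width G 1 \<longleftrightarrow> layered_pathwidth G = 1"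
  proof
    assume "has_layered_width G 1"
    then have "layered_pathwidth G \<le> 1" unfolding layered_pathwidth_def by (rule Least_le)
    moreover have "0 < layered_pathwidth G"
      using layered_width_pos[OF assms has_layered_width_layered_pathwidth[OF assms(1)]] .
    ultimately show "layered_pathwidth G = 1" by simp
  next
    assume "layered_pathwidth G = 1"
    then show "has_layered_width G 1"
      using has_layered_width_layered_pathwidth[OF assms(1)] by simp
  qed
  then show ?thesis using leveled_planar_iff_layered_width_1[OF assms(1)] by simp
qed

end
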